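(* Let $\langle\cdot,\cdot\rangle$ be a quasi-definite bilinear form on $\mathbb{C}[x]$ with biorthogonal polynomials $P_{1,k},P_{2,k}$ and spectral matrices $J_1,J_2$. For $i\in\{1,2\}$ and $k\ge1$, the roots of $P_{i,k}(z)$ and the eigenvalues of the truncation $J_i^{[k]}$ coincide.
   Context: The Gram matrix is $G_{k,l}=\langle x^k,y^l\rangle$, $k,l\ge0$. The form is quasi-definite if all leading principal minors of $G$ are nonzero; then uniquely $G=S_1^{-1}HS_2^{-\top}$ with $S_1,S_2$ lower unitriangular and $H$ diagonal. With $\chi(x)=(1,x,x^2,\dots)^\top$, $P_{i,k}$ is the $k$-th entry ($k=0,1,\dots$) of $S_i\chi$, a monic polynomial of degree $k$. $\Lambda$ is the semi-infinite shift matrix, $\Lambda_{i,j}=\delta_{i+1,j}$ (so $\Lambda\chi(x)=x\chi(x)$), and the spectral matrices are $J_i=S_i\Lambda S_i^{-1}$, $i=1,2$. For a semi-infinite matrix $M=(M_{i,j})_{i,j\ge0}$, $M^{[k]}=(M_{i,j})_{i,j=0}^{k-1}$ is its leading $k\times k$ truncation. *)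

theory Defs
  imports "Jordan_Normal_Form.Char_Poly" "HOL-Library.Groups_Big_Fun"
begin

type_synonym semi_inf_mat = "nat \<Rightarrow> nat \<Rightarrow> complex"

(* Every product used below has only finitely many nonzero summands in each entry, so the value
   0 that Sum_any assigns to sums of infinite support never plays a role. *)
definition smi_mult :: "semi_inf_mat \<Rightarrow> semi_inf_mat \<Rightarrow> semi_inf_mat"  (infixl "**" 70)
  where "A ** B = (\<lambda>i j. Sum_any (\<lambda>l. A i l * B l j))"

definition smi_one :: semi_inf_mat
  where "smi_one = (\<lambda>i j. if i = j then 1 else 0)"

definition smi_transpose :: "semi_inf_mat \<Rightarrow> semi_inf_mat"
  where "smi_transpose A = (\<lambda>i j. A j i)"

definition smi_diagonal :: "semi_inf_mat \<Rightarrow> bool"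
  where "smi_diagonal A \<longleftrightarrow> (\<forall>i j. i \<noteq> j \<longrightarrow> A i j = 0)"

definition lower_unitriangular :: "semi_inf_mat \<Rightarrow> bool"
  where "lower_unitriangular A \<longleftrightarrow> (\<forall>i. A i i = 1) \<and> (\<forall>i j. i < j \<longrightarrow> A i j = 0)"

(* The inverse in the group of lower unitriangular matrices: inverses among arbitrary
   semi-infinite matrices need not be unique. Only meaningful for lower unitriangular A. *)
definition smi_inv :: "semi_inf_mat \<Rightarrow> semi_inf_mat"
  where "smi_inv A = (THE B. lower_unitriangular B \<and> A ** B = smi_one \<and> B ** A = smi_one)"

definition shift_mat :: semi_inf_mat
  where "shift_mat = (\<lambda>i j. if i + 1 = j then 1 else 0)"

definition truncation :: "semi_inf_mat \<Rightarrow> nat \<Rightarrow> complex mat"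
  where "truncation A k = mat k k (\<lambda>(i, j). A i j)"

definition bilinear_form :: "(complex poly \<Rightarrow> complex poly \<Rightarrow> complex) \<Rightarrow> bool"
  where "bilinear_form B \<longleftrightarrow>
    (\<forall>p. Vector_Spaces.linear Polynomial.smult (*) (\<lambda>q. B p q)) \<and>
    (\<forall>q. Vector_Spaces.linear Polynomial.smult (*) (\<lambda>p. B p q))"

definition gram_matrix :: "(complex poly \<Rightarrow> complex poly \<Rightarrow> complex) \<Rightarrow> semi_inf_mat"
  where "gram_matrix B = (\<lambda>k l. B (monom 1 k) (monom 1 l))"

definition quasi_definite :: "(complex poly \<Rightarrow> complex poly \<Rightarrow> complex) \<Rightarrow> bool"
  where "quasi_definite B \<longleftrightarrow> (\<forall>k\<ge>1. det (truncation (gram_matrix B) k) \<noteq> 0)"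

definition gauss_borel :: "semi_inf_mat \<Rightarrow> semi_inf_mat \<Rightarrow> semi_inf_mat \<Rightarrow> semi_inf_mat \<Rightarrow> bool"
  where "gauss_borel G S1 H S2 \<longleftrightarrow>
    lower_unitriangular S1 \<and> lower_unitriangular S2 \<and> smi_diagonal H \<and>
    G = smi_inv S1 ** H ** smi_transpose (smi_inv S2)"

(* The k-th entry of S \<chi>, where \<chi> = (1, x, x^2, ...). *)
definition biorth_poly :: "semi_inf_mat \<Rightarrow> nat \<Rightarrow> complex poly"
  where "biorth_poly S k = Sum_any (\<lambda>l. Polynomial.smult (S k l) (monom 1 l))"

definition spectral_matrix :: "semi_inf_mat \<Rightarrow> semi_inf_mat"
  where "spectral_matrix S = S ** shift_mat ** smi_inv S"

end

theory Submission
  imports Defs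
begin

text \<open>
  Write \<open>S\<close> for the lower unitriangular factor under consideration and \<open>P k\<close> for the entries of
  \<open>S \<chi>\<close>. Since \<open>\<Lambda> \<chi> = x \<chi>\<close>, the spectral matrix \<open>J = S \<Lambda> S\<inverse>\<close> represents multiplication by \<open>x\<close> in
  the basis \<open>P 0, P 1, \<dots>\<close>. It is lower Hessenberg with ones on the superdiagonal, so the only
  trace of the basis outside the first \<open>k\<close> polynomials in the first \<open>k\<close> rows of \<open>J P = x P\<close> is
  the single term \<open>P k\<close> in row \<open>k - 1\<close>. Hence the truncation of \<open>J\<close> represents multiplication by
  \<open>x\<close> on \<open>\<complex>[x]\<close> modulo \<open>P k\<close> in the basis \<open>P 0, \<dots>, P (k - 1)\<close>, whereas in the basis
  \<open>1, x, \<dots>, x ^ (k - 1)\<close> this map is the companion matrix of \<open>P k\<close>. The leading \<open>k \<times> k\<close> block of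
  \<open>S\<close> is the change of basis; this is \<open>truncation_spectral_similar_companion\<close>.

  The characteristic polynomial of the companion matrix of \<open>P k\<close> is \<open>P k\<close>
  (\<open>char_poly_companion_mat\<close>), so the characteristic polynomial of the truncation equals \<open>P k\<close>
  itself, which gives the equality of roots and eigenvalues together with their multiplicities.

  The similarity comes from \<open>J S = S \<Lambda>\<close>, an identity of infinite matrices that rests
  on associativity of products and on \<open>S\<inverse>\<close> being a two-sided inverse. Associativity is available
  because all matrices concerned have finitely supported rows.
\<close>

section \<open>Semi-infinite matrices with finitely supported rows\<close>

definition row_finite :: "semi_inf_mat \<Rightarrow> bool"
  where "row_finite A \<longleftrightarrow> (\<forall>i. finite {l. A i l \<noteq> 0})"

lemma smi_mult_eq_sum:
  assumes "finite F" and "\<And>l. l \<notin> F \<Longrightarrow> A i l = 0"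
  shows "(A ** B) i j = (\<Sum>l\<in>F. A i l * B l j)"
  unfolding smi_mult_def
  by (rule Sum_any.expand_superset) (use assms in auto)

lemma smi_mult_assoc:
  assumes A: "row_finite A" and B: "row_finite B"
  shows "(A ** B) ** C = A ** (B ** C)"
proof (intro ext)
  fix i j
  define F where "F = {l. A i l \<noteq> 0}"
  define K where "K = (\<Union>l\<in>F. {m. B l m \<noteq> 0})"
  have F: "finite F" using A by (simp add: F_def row_finite_def)
  have K: "finite K" using B F by (auto simp: K_def row_finite_def)
  have AB: "(A ** B) i m = (\<Sum>l\<in>F. A i l * B l m)" for m
    by (rule smi_mult_eq_sum[OF F]) (simp add: F_def)
  have BC: "(B ** C) l j = (\<Sum>m\<in>K. B l m * C m j)" if "l \<in> F" for l
    by (rule smi_mult_eq_sum[OF K]) (use that in \<open>auto simp: K_def\<close>)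
  have "((A ** B) ** C) i j = (\<Sum>m\<in>K. (A ** B) i m * C m j)"
    by (rule smi_mult_eq_sum[OF K]) (auto simp: AB K_def intro!: sum.neutral)
  also have "\<dots> = (\<Sum>m\<in>K. \<Sum>l\<in>F. A i l * (B l m * C m j))"
    by (simp add: AB sum_distrib_right mult.assoc)
  also have "\<dots> = (\<Sum>l\<in>F. A i l * (\<Sum>m\<in>K. B l m * C m j))"
    by (subst sum.swap) (simp add: sum_distrib_left)
  also have "\<dots> = (\<Sum>l\<in>F. A i l * (B ** C) l j)"
    by (simp add: BC)
  also have "\<dots> = (A ** (B ** C)) i j"
    by (rule smi_mult_eq_sum[OF F, symmetric]) (simp add: F_def)
  finally show "((A ** B) ** C) i j = (A ** (B ** C)) i j" .
qed

lemma smi_mult_one_right: "row_finite A \<Longrightarrow> A ** smi_one = A"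
  by (intro ext, subst smi_mult_eq_sum[where F = "insert j {l. A i l \<noteq> 0}" for i j])
     (auto simp: smi_one_def row_finite_def if_distrib[of "times _"] cong: if_cong)

lemma smi_mult_one_left: "smi_one ** A = A"
  by (intro ext, subst smi_mult_eq_sum[where F = "{i}" for i]) (auto simp: smi_one_def)

lemma row_finite_shift: "row_finite shift_mat"
  unfolding row_finite_def shift_mat_def by simp

section \<open>The group of lower unitriangular matrices\<close>

lemma lower_unitriangular_row_finite:
  assumes "lower_unitriangular A"
  shows "row_finite A"
  unfolding row_finite_def
proof
  fix i
  have "{l. A i l \<noteq> 0} \<subseteq> {..i}"
    using assms by (auto simp: lower_unitriangular_def not_less[symmetric])
  then show "finite {l. A i l \<noteq> 0}" by (rule finite_subset) simp
qed

lemma lower_unitriangular_mult: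
  assumes "lower_unitriangular A"
  shows "(A ** B) i j = (\<Sum>l\<le>i. A i l * B l j)"
  by (rule smi_mult_eq_sum) (use assms in \<open>auto simp: lower_unitriangular_def\<close>)

text \<open>
  Forward substitution: the \<open>i\<close>-th row of \<open>A ** X = smi_one\<close> is solved for the \<open>i\<close>-th row of \<open>X\<close>.
\<close>
fun forward_subst :: "semi_inf_mat \<Rightarrow> nat \<Rightarrow> nat \<Rightarrow> complex"
  where "forward_subst A i j = (if i = j then 1 else 0) - (\<Sum>l<i. A i l * forward_subst A l j)"

declare forward_subst.simps [simp del]

lemma lower_unitriangular_forward_subst: "lower_unitriangular (forward_subst A)"
proof -
  have above: "forward_subst A i j = 0" if "i < j" for i j
    using that
  proof (induction i rule: less_induct)
    case (less i)
    then show ?case by (subst forward_subst.simps) simp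
  qed
  have "forward_subst A i i = 1" for i
    by (subst forward_subst.simps) (simp add: above)
  with above show ?thesis by (simp add: lower_unitriangular_def)
qed

lemma mult_forward_subst:
  assumes "lower_unitriangular A"
  shows "A ** forward_subst A = smi_one"
proof (intro ext)
  fix i j
  have "(A ** forward_subst A) i j
      = (\<Sum>l<i. A i l * forward_subst A l j) + A i i * forward_subst A i j"
    by (simp add: lower_unitriangular_mult[OF assms] lessThan_Suc_atMost[symmetric])
  then show "(A ** forward_subst A) i j = smi_one i j"
    using assms forward_subst.simps[of A i j]
    by (simp add: lower_unitriangular_def smi_one_def)
qed

text \<open>
  A monoid in which every element has a right inverse is a group: a right inverse \<open>X\<close> of \<open>A\<close> has
  a right inverse \<open>Y\<close> in turn, and \<open>Y = A X Y = A\<close>.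
\<close>
lemma lower_unitriangular_inverse_unique_existence:
  assumes A: "lower_unitriangular A"
  shows "\<exists>!X. lower_unitriangular X \<and> A ** X = smi_one \<and> X ** A = smi_one"
proof -
  define X where "X = forward_subst A"
  define Y where "Y = forward_subst X"
  have X: "lower_unitriangular X" and Y: "lower_unitriangular Y"
    unfolding X_def Y_def by (rule lower_unitriangular_forward_subst)+
  have AX: "A ** X = smi_one" unfolding X_def by (rule mult_forward_subst[OF A])
  have XY: "X ** Y = smi_one" unfolding Y_def by (rule mult_forward_subst[OF X])
  note rf = lower_unitriangular_row_finite
  have "Y = (A ** X) ** Y" by (simp add: AX smi_mult_one_left)
  also have "\<dots> = A ** (X ** Y)" by (rule smi_mult_assoc) (use A X rf in auto)
  also have "\<dots> = A" using XY rf[OF A] by (simp add: smi_mult_one_right)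
  finally have XA: "X ** A = smi_one" using XY by simp
  have "Z = X" if "lower_unitriangular Z" "A ** Z = smi_one" for Z
  proof -
    have "Z = (X ** A) ** Z" by (simp add: XA smi_mult_one_left)
    also have "\<dots> = X ** (A ** Z)" by (rule smi_mult_assoc) (use A X rf in auto)
    also have "\<dots> = X" using that rf[OF X] by (simp add: smi_mult_one_right)
    finally show ?thesis .
  qed
  with X AX XA show ?thesis by blast
qed

lemma smi_inv_props:
  assumes "lower_unitriangular A"
  shows lower_unitriangular_smi_inv: "lower_unitriangular (smi_inv A)"
    and smi_inv_right: "A ** smi_inv A = smi_one"
    and smi_inv_left: "smi_inv A ** A = smi_one"
  using theI'[OF lower_unitriangular_inverse_unique_existence[OF assms]]
  unfolding smi_inv_def by auto

lemma truncation_mult: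
  assumes A: "lower_unitriangular A"
  shows "truncation A k * truncation B k = truncation (A ** B) k"
proof (rule eq_matI)
  fix i j assume "i < dim_row (truncation (A ** B) k)" "j < dim_col (truncation (A ** B) k)"
  then have i: "i < k" and j: "j < k" by (auto simp: truncation_def)
  have "(\<Sum>l<k. A i l * B l j) = (A ** B) i j"
    by (rule smi_mult_eq_sum[symmetric])
       (use A i in \<open>auto simp: lower_unitriangular_def\<close>)
  with i j show "(truncation A k * truncation B k) $$ (i, j) = truncation (A ** B) k $$ (i, j)"
    by (simp add: truncation_def scalar_prod_def atLeast0LessThan)
qed (auto simp: truncation_def)

lemma truncation_one: "truncation smi_one k = 1\<^sub>m k"
  by (rule eq_matI) (auto simp: truncation_def smi_one_def)

lemma truncation_carrier: "truncation A k \<in> carrier_mat k k"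
  by (simp add: truncation_def)

section \<open>Companion matrices\<close>

text \<open>
  Laplace expansion along the first column meets at most two nonzero entries. Deleting the first row
  and column leaves a matrix of the same shape; deleting the first column and the last row leaves
  a lower triangular matrix with diagonal entries \<open>-1\<close>, whose sign cancels that of the cofactor.
  This is Horner's scheme for \<open>r 0 + x * (r 1 + x * (r 2 + \<dots>))\<close>.
\<close>
lemma det_bidiagonal_last_row:
  fixes x :: "'a :: comm_ring_1"
  shows "det (mat (Suc n) (Suc n)
           (\<lambda>(i, j). if i = n then r j else if j = i then x else if j = Suc i then - 1 else 0))
         = (\<Sum>j\<le>n. r j * x ^ j)"
proof (induction n arbitrary: r)
  case 0
  show ?case by (simp add: det_single)
next
  case (Suc n)
  let ?M = "mat (Suc (Suc n)) (Suc (Suc n))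
    (\<lambda>(i, j). if i = Suc n then r j else if j = i then x else if j = Suc i then - 1 else 0)"
  have "det ?M = (\<Sum>i<Suc (Suc n). ?M $$ (i, 0) * cofactor ?M i 0)"
    by (rule laplace_expansion_column) auto
  also have "\<dots> = (\<Sum>i\<in>{0, Suc n}. ?M $$ (i, 0) * cofactor ?M i 0)"
    by (rule sum.mono_neutral_right) auto
  also have "\<dots> = x * cofactor ?M 0 0 + r 0 * cofactor ?M (Suc n) 0"
    by simp
  also have "cofactor ?M 0 0 = (\<Sum>j\<le>n. r (Suc j) * x ^ j)"
  proof -
    have "mat_delete ?M 0 0 = mat (Suc n) (Suc n) (\<lambda>(i, j).
        if i = n then r (Suc j) else if j = i then x else if j = Suc i then - 1 else 0)"
      by (rule eq_matI) (auto simp: mat_delete_def)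
    then show ?thesis by (simp add: cofactor_def Suc.IH[of "\<lambda>j. r (Suc j)"])
  qed
  also have "cofactor ?M (Suc n) 0 = 1"
  proof -
    let ?L = "mat_delete ?M (Suc n) 0"
    have L: "?L = mat (Suc n) (Suc n)
        (\<lambda>(i, j). if j = i then - 1 else if Suc j = i then x else 0)"
      by (rule eq_matI) (auto simp: mat_delete_def)
    have "det ?L = prod_list (diag_mat ?L)"
      by (rule det_lower_triangular[of "Suc n"]) (auto simp: L)
    also have "diag_mat ?L = map (\<lambda>_. - 1) [0..<Suc n]"
      unfolding L diag_mat_def by (rule map_cong) auto
    also have "prod_list \<dots> = (- 1) ^ Suc n"
      by (simp only: map_replicate_const prod_list_replicate length_upt diff_zero)
    finally show ?thesis
      by (simp add: cofactor_def power_mult_distrib[symmetric])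
  qed
  also have "x * (\<Sum>j\<le>n. r (Suc j) * x ^ j) + r 0 * 1 = (\<Sum>j\<le>Suc n. r j * x ^ j)"
    by (simp add: sum.atMost_Suc_shift sum_distrib_left algebra_simps del: sum.atMost_Suc)
  finally show ?case .
qed

text \<open>
  Multiplication by the variable, modulo \<open>x ^ k + (\<Sum>j<k. c j * x ^ j)\<close>, in the monomial basis
  with coordinates as rows.
\<close>
definition companion_mat :: "nat \<Rightarrow> (nat \<Rightarrow> 'a :: comm_ring_1) \<Rightarrow> 'a mat"
  where "companion_mat k c = mat k k
    (\<lambda>(i, j). if Suc i = k then - c j else if j = Suc i then 1 else 0)"

lemma char_poly_companion_mat:
  fixes c :: "nat \<Rightarrow> 'a :: comm_ring_1"
  assumes "k \<ge> 1"
  shows "char_poly (companion_mat k c) = monom 1 k + (\<Sum>j<k. monom (c j) j)"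
proof -
  obtain n where k: "k = Suc n" using assms by (cases k) auto
  define r where "r = (\<lambda>j. [:c j:] + (if j = n then [:0, 1:] else 0))"
  have monom: "[:a:] * [:0, 1:] ^ j = monom a j" for a :: 'a and j
    by (simp add: monom_altdef)
  have "char_poly_matrix (companion_mat k c) = mat (Suc n) (Suc n)
      (\<lambda>(i, j). if i = n then r j else if j = i then [:0, 1:] else if j = Suc i then - 1 else 0)"
    by (rule eq_matI) (auto simp: k char_poly_matrix_def companion_mat_def r_def one_pCons)
  then have "char_poly (companion_mat k c) = (\<Sum>j\<le>n. r j * [:0, 1:] ^ j)"
    by (simp only: char_poly_def det_bidiagonal_last_row)
  also have "\<dots> = (\<Sum>j\<le>n. [:c j:] * [:0, 1:] ^ j)
      + (\<Sum>j\<le>n. if j = n then [:0, 1:] ^ Suc n else 0)"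
    unfolding sum.distrib[symmetric]
    by (rule sum.cong) (auto simp: r_def distrib_right)
  also have "\<dots> = (\<Sum>j\<le>n. monom (c j) j) + [:0, 1:] ^ Suc n"
    by (simp only: monom sum.delta finite_atMost atMost_iff order.refl if_True)
  also have "[:0, 1:] ^ Suc n = monom (1 :: 'a) (Suc n)"
    by (simp only: monom_altdef smult_1_left)
  finally show ?thesis by (simp add: k lessThan_Suc_atMost add.commute)
qed

section \<open>Truncations of the spectral matrix\<close>

lemma mult_shift_mat:
  assumes "lower_unitriangular S"
  shows "(S ** shift_mat) i j = (if j = 0 then 0 else S i (j - 1))"
proof (cases j)
  case 0
  then show ?thesis
    by (simp add: lower_unitriangular_mult[OF assms] shift_mat_def)
next
  case (Suc m)
  have "(S ** shift_mat) i j = (\<Sum>l\<le>i. if l = m then S i m else 0)"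
    unfolding lower_unitriangular_mult[OF assms] by (rule sum.cong) (auto simp: shift_mat_def Suc)
  also have "\<dots> = S i m"
    using assms by (auto simp: lower_unitriangular_def)
  finally show ?thesis by (simp add: Suc)
qed

lemma row_finite_mult_shift_mat:
  assumes "lower_unitriangular S"
  shows "row_finite (S ** shift_mat)"
  unfolding row_finite_def
proof
  fix i
  have "{l. (S ** shift_mat) i l \<noteq> 0} \<subseteq> {..Suc i}"
    using assms by (auto simp: mult_shift_mat lower_unitriangular_def not_less[symmetric]
      split: if_splits)
  then show "finite {l. (S ** shift_mat) i l \<noteq> 0}" by (rule finite_subset) simp
qed

lemma spectral_matrix_entry:
  assumes S: "lower_unitriangular S"
  shows "spectral_matrix S i j = (\<Sum>l\<le>Suc i. (S ** shift_mat) i l * smi_inv S l j)"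
  unfolding spectral_matrix_def
  by (rule smi_mult_eq_sum)
     (use S in \<open>auto simp: mult_shift_mat lower_unitriangular_def\<close>)

lemma spectral_matrix_hessenberg:
  assumes S: "lower_unitriangular S"
  shows spectral_matrix_above_superdiag: "Suc i < j \<Longrightarrow> spectral_matrix S i j = 0"
    and spectral_matrix_superdiag: "spectral_matrix S i (Suc i) = 1"
proof -
  note T = lower_unitriangular_smi_inv[OF S]
  show "spectral_matrix S i j = 0" if "Suc i < j"
    unfolding spectral_matrix_entry[OF S]
    by (rule sum.neutral) (use T that in \<open>auto simp: lower_unitriangular_def\<close>)
  have "spectral_matrix S i (Suc i)
      = (S ** shift_mat) i (Suc i) * smi_inv S (Suc i) (Suc i)"
    using T by (simp add: spectral_matrix_entry[OF S] lower_unitriangular_def)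
  then show "spectral_matrix S i (Suc i) = 1"
    using S T by (simp add: mult_shift_mat lower_unitriangular_def)
qed

text \<open>
  Applied to \<open>\<chi>\<close>, this is the recurrence that expands \<open>x * P i\<close> in the polynomials
  \<open>P 0, \<dots>, P (i + 1)\<close>.
\<close>
lemma spectral_matrix_mult:
  assumes S: "lower_unitriangular S"
  shows "spectral_matrix S ** S = S ** shift_mat"
proof -
  have "spectral_matrix S ** S = (S ** shift_mat) ** (smi_inv S ** S)"
    unfolding spectral_matrix_def
    by (intro smi_mult_assoc row_finite_mult_shift_mat lower_unitriangular_row_finite
        lower_unitriangular_smi_inv S)
  then show ?thesis
    by (simp add: smi_inv_left[OF S] smi_mult_one_right row_finite_mult_shift_mat[OF S])
qed

text \<open>
  Cutting \<open>J S = S \<Lambda>\<close> down to size \<open>k\<close> loses a single product, \<open>J (k - 1) k * S k j = S k j\<close> in the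
  last row. Subtracting it from the last row of the truncated shift, where the factor
  \<open>S (k - 1) (k - 1) = 1\<close> makes it appear unchanged, yields the companion matrix of the
  coefficients in row \<open>k\<close> of \<open>S\<close>.
\<close>
lemma truncation_spectral_mult:
  assumes S: "lower_unitriangular S"
  shows "truncation (spectral_matrix S) k * truncation S k
       = truncation S k * companion_mat k (S k)"
proof (rule eq_matI)
  let ?J = "spectral_matrix S"
  fix i j
  assume "i < dim_row (truncation S k * companion_mat k (S k))"
    and "j < dim_col (truncation S k * companion_mat k (S k))"
  then have i: "i < k" and j: "j < k" by (auto simp: truncation_def companion_mat_def)
  define e where "e = (if Suc i = k then S k j else 0)"
  have "(S ** shift_mat) i j = (\<Sum>l\<le>k. ?J i l * S l j)"
    unfolding spectral_matrix_mult[OF S, symmetric]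
    by (rule smi_mult_eq_sum) (use i spectral_matrix_above_superdiag[OF S] in auto)
  also have "\<dots> = (\<Sum>l<k. ?J i l * S l j) + ?J i k * S k j"
    by (simp add: lessThan_Suc_atMost[symmetric])
  also have "?J i k * S k j = e"
    using i spectral_matrix_superdiag[OF S, of i] spectral_matrix_above_superdiag[OF S, of i k]
    by (auto simp: e_def)
  finally have left: "(\<Sum>l<k. ?J i l * S l j) = (S ** shift_mat) i j - e" by simp
  have "(\<Sum>l<k. S i l * (if Suc l = k then - S k j else if j = Suc l then 1 else 0))
      = (\<Sum>l<k. S i l * shift_mat l j) - (\<Sum>l<k. if Suc l = k then S i l * S k j else 0)"
    unfolding sum_subtractf[symmetric]
    by (rule sum.cong) (use j in \<open>auto simp: shift_mat_def\<close>)
  also have "(\<Sum>l<k. S i l * shift_mat l j) = (S ** shift_mat) i j"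
    by (rule smi_mult_eq_sum[symmetric])
       (use S i in \<open>auto simp: lower_unitriangular_def\<close>)
  also have "(\<Sum>l<k. if Suc l = k then S i l * S k j else 0) = e"
  proof -
    have "(\<Sum>l<k. if Suc l = k then S i l * S k j else 0)
        = (\<Sum>l\<in>{k - 1}. S i l * S k j)"
      by (rule sum.mono_neutral_cong_right) (use i in auto)
    also have "\<dots> = e"
      using S i by (auto simp: e_def lower_unitriangular_def)
    finally show ?thesis .
  qed
  finally have "(\<Sum>l<k. S i l * (if Suc l = k then - S k j else if j = Suc l then 1 else 0))
      = (S ** shift_mat) i j - e" .
  with left i j show "(truncation ?J k * truncation S k) $$ (i, j)
      = (truncation S k * companion_mat k (S k)) $$ (i, j)"
    by (simp add: truncation_def companion_mat_def scalar_prod_def atLeast0LessThan)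
qed (auto simp: truncation_def companion_mat_def)

lemma truncation_spectral_similar_companion:
  assumes S: "lower_unitriangular S"
  shows "similar_mat (truncation (spectral_matrix S) k) (companion_mat k (S k))"
proof (rule similar_matI)
  let ?J = "truncation (spectral_matrix S) k" and ?C = "companion_mat k (S k)"
  let ?P = "truncation S k" and ?Q = "truncation (smi_inv S) k"
  note T = lower_unitriangular_smi_inv[OF S]
  show carr: "{?J, ?C, ?P, ?Q} \<subseteq> carrier_mat k k"
    by (auto simp: truncation_def companion_mat_def)
  show PQ: "?P * ?Q = 1\<^sub>m k" and "?Q * ?P = 1\<^sub>m k"
    by (simp_all add: truncation_mult S T smi_inv_right smi_inv_left truncation_one)
  have "?P * ?C * ?Q = ?J * (?P * ?Q)"
    unfolding truncation_spectral_mult[OF S, symmetric]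
    by (rule assoc_mult_mat) (rule truncation_carrier)+
  then show "?J = ?P * ?C * ?Q"
    by (simp add: PQ right_mult_one_mat[OF truncation_carrier])
qed

lemma biorth_poly_eq_sum:
  assumes S: "lower_unitriangular S"
  shows "biorth_poly S k = monom 1 k + (\<Sum>j<k. monom (S k j) j)"
proof -
  have "biorth_poly S k = (\<Sum>j\<le>k. monom (S k j) j)"
    unfolding biorth_poly_def
    by (subst Sum_any.expand_superset[where A = "{..k}"])
       (use S in \<open>auto simp: lower_unitriangular_def smult_monom not_less[symmetric]\<close>)
  with S show ?thesis
    by (simp add: lessThan_Suc_atMost[symmetric] lower_unitriangular_def add.commute)
qed

theorem char_poly_truncation_spectral_matrix:
  assumes S: "lower_unitriangular S" and k: "k \<ge> 1"
  shows "char_poly (truncation (spectral_matrix S) k) = biorth_poly S k"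
  by (simp add: char_poly_similar[OF truncation_spectral_similar_companion[OF S]]
      char_poly_companion_mat[OF k] biorth_poly_eq_sum[OF S])

theorem proposition11:
  fixes B :: "complex poly \<Rightarrow> complex poly \<Rightarrow> complex"
    and S :: "nat \<Rightarrow> semi_inf_mat" and H :: semi_inf_mat
    and i k :: nat
  assumes "bilinear_form B"
    and "quasi_definite B"
    and "gauss_borel (gram_matrix B) (S 1) H (S 2)"
    and "i \<in> {1, 2}"
    and "k \<ge> 1"
  shows "{z. poly (biorth_poly (S i) k) z = 0}
           = {z. eigenvalue (truncation (spectral_matrix (S i)) k) z} \<and>
         (\<forall>z. order z (biorth_poly (S i) k)
           = order z (char_poly (truncation (spectral_matrix (S i)) k)))"
proof -
  have S: "lower_unitriangular (S i)"
    using assms(3,4) by (auto simp: gauss_borel_def)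
  show ?thesis
    using char_poly_truncation_spectral_matrix[OF S \<open>k \<ge> 1\<close>]
    by (simp add: eigenvalue_root_char_poly[OF truncation_carrier])
qed

end
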